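(* For any 2SUIG $G$, all the maximal cliques of $G$ can be enumerated, and hence the clique number $\omega(G)$ can be computed, in polynomial time.
   Context: Fix a constant $\epsilon\in(0,1)$. The lower stab line is $y=1$ and the upper stab line is $y=2+\epsilon$. A 2-stab interval graph (2SIG) is a graph that is the intersection graph of a family of axis-parallel rectangles, each of height $1$ (side parallel to the $Y$-axis), each intersecting one of the two stab lines. A 2SUIG (2-stab unit interval graph) is a 2SIG having such a representation in which every rectangle is a unit square. In such a representation the lower partition $V_1$ is the set of vertices whose squares meet $y=1$ and the upper partition $V_2$ the set of those whose squares meet $y=2+\epsilon$. *)

theory Defs
  imports "HOL-Analysis.Analysis" "HOL-Computational_Algebra.Polynomial"
begin

section \<open>Graphs and cliques\<close>

definition simple_graph :: "'a set \<Rightarrow> 'a set set \<Rightarrow> bool" where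
  "simple_graph V E \<longleftrightarrow> finite V \<and> E \<subseteq> {{u, v} | u v. u \<in> V \<and> v \<in> V \<and> u \<noteq> v}"

definition clique :: "'a set \<Rightarrow> 'a set set \<Rightarrow> 'a set \<Rightarrow> bool" where
  "clique V E C \<longleftrightarrow> C \<subseteq> V \<and> (\<forall>u\<in>C. \<forall>v\<in>C. u \<noteq> v \<longrightarrow> {u, v} \<in> E)"

definition maximal_clique :: "'a set \<Rightarrow> 'a set set \<Rightarrow> 'a set \<Rightarrow> bool" where
  "maximal_clique V E C \<longleftrightarrow> clique V E C \<and> (\<forall>D. clique V E D \<and> C \<subseteq> D \<longrightarrow> D = C)"

definition clique_number :: "'a set \<Rightarrow> 'a set set \<Rightarrow> nat" where
  "clique_number V E = Max (card ` {C. clique V E C})"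


section \<open>2-stab (unit) interval graphs\<close>

definition stab_line :: "real \<Rightarrow> (real \<times> real) set" where
  "stab_line c = {p. snd p = c}"

definition height1_rectangle :: "real \<Rightarrow> (real \<times> real) set \<Rightarrow> bool" where
  "height1_rectangle w S \<longleftrightarrow> (\<exists>a b. S = cbox (a, b) (a + w, b + 1))"

definition intersection_graph :: "'a set \<Rightarrow> 'a set set \<Rightarrow> ('a \<Rightarrow> 'b set) \<Rightarrow> bool" where
  "intersection_graph V E R \<longleftrightarrow>
     (\<forall>u\<in>V. \<forall>v\<in>V. u \<noteq> v \<longrightarrow> ({u, v} \<in> E \<longleftrightarrow> R u \<inter> R v \<noteq> {}))"

text \<open>Since the two lines are more than \<open>1\<close> apart, the disjunction below is exclusive
  whenever \<open>\<epsilon> > 0\<close>.\<close>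

definition two_stab_representation ::
    "real \<Rightarrow> 'a set \<Rightarrow> 'a set set \<Rightarrow> ('a \<Rightarrow> (real \<times> real) set) \<Rightarrow> bool" where
  "two_stab_representation \<epsilon> V E R \<longleftrightarrow>
     (\<forall>v\<in>V. (\<exists>w>0. height1_rectangle w (R v)) \<and>
            (R v \<inter> stab_line 1 \<noteq> {} \<or> R v \<inter> stab_line (2 + \<epsilon>) \<noteq> {})) \<and>
     intersection_graph V E R"

definition is_2SIG :: "real \<Rightarrow> 'a set \<Rightarrow> 'a set set \<Rightarrow> bool" where
  "is_2SIG \<epsilon> V E \<longleftrightarrow> simple_graph V E \<and> (\<exists>R. two_stab_representation \<epsilon> V E R)"

definition is_2SUIG :: "real \<Rightarrow> 'a set \<Rightarrow> 'a set set \<Rightarrow> bool" where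
  "is_2SUIG \<epsilon> V E \<longleftrightarrow> simple_graph V E \<and>
     (\<exists>R. two_stab_representation \<epsilon> V E R \<and> (\<forall>v\<in>V. height1_rectangle 1 (R v)))"


section \<open>Random access machines and polynomial time\<close>

text \<open>A RAM with registers and an indirectly addressed memory, both holding natural numbers,
  programmed by structured commands. Every evaluated node of an expression and every executed
  command costs one step. There is no multiplication, so polynomial time in this unit-cost model
  is the same as polynomial time on Turing machines. \<open>Sub\<close> is truncated subtraction.\<close>

datatype aexp = Const nat | Reg nat | Load aexp | Add aexp aexp | Sub aexp aexp

datatype com =
    Skip
  | Assign nat aexp
  | Store aexp aexp
  | Seq com com
  | Cond aexp com com
  | While aexp com

type_synonym ram_state = "(nat \<Rightarrow> nat) \<times> (nat \<Rightarrow> nat)"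

fun aval :: "aexp \<Rightarrow> ram_state \<Rightarrow> nat" where
  "aval (Const c) s = c"
| "aval (Reg r) s = fst s r"
| "aval (Load a) s = snd s (aval a s)"
| "aval (Add a b) s = aval a s + aval b s"
| "aval (Sub a b) s = aval a s - aval b s"

fun acost :: "aexp \<Rightarrow> nat" where
  "acost (Const c) = 1"
| "acost (Reg r) = 1"
| "acost (Load a) = Suc (acost a)"
| "acost (Add a b) = Suc (acost a + acost b)"
| "acost (Sub a b) = Suc (acost a + acost b)"

text \<open>\<open>exec c s t s'\<close>: started in state \<open>s\<close>, command \<open>c\<close> halts in state \<open>s'\<close> after exactly
  \<open>t\<close> steps.\<close>

inductive exec :: "com \<Rightarrow> ram_state \<Rightarrow> nat \<Rightarrow> ram_state \<Rightarrow> bool" where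
  Skip: "exec Skip s 1 s"
| Assign: "exec (Assign r a) s (1 + acost a) ((fst s)(r := aval a s), snd s)"
| Store: "exec (Store a b) s (1 + acost a + acost b) (fst s, (snd s)(aval a s := aval b s))"
| Seq: "exec c\<^sub>1 s t\<^sub>1 s' \<Longrightarrow> exec c\<^sub>2 s' t\<^sub>2 s'' \<Longrightarrow> exec (Seq c\<^sub>1 c\<^sub>2) s (1 + t\<^sub>1 + t\<^sub>2) s''"
| CondTrue: "aval a s \<noteq> 0 \<Longrightarrow> exec c\<^sub>1 s t s' \<Longrightarrow> exec (Cond a c\<^sub>1 c\<^sub>2) s (1 + acost a + t) s'"
| CondFalse: "aval a s = 0 \<Longrightarrow> exec c\<^sub>2 s t s' \<Longrightarrow> exec (Cond a c\<^sub>1 c\<^sub>2) s (1 + acost a + t) s'"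
| WhileFalse: "aval a s = 0 \<Longrightarrow> exec (While a c) s (1 + acost a) s"
| WhileTrue: "aval a s \<noteq> 0 \<Longrightarrow> exec c s t\<^sub>1 s' \<Longrightarrow> exec (While a c) s' t\<^sub>2 s'' \<Longrightarrow>
    exec (While a c) s (1 + acost a + t\<^sub>1 + t\<^sub>2) s''"

lemma exec_deterministic:
  "exec c s t s' \<Longrightarrow> exec c s u s'' \<Longrightarrow> u = t \<and> s'' = s'"
proof (induction arbitrary: u s'' rule: exec.induct)
  case (Skip s)
  from Skip.prems show ?case by cases simp
next
  case (Assign r a s)
  from Assign.prems show ?case by cases simp
next
  case (Store a b s)
  from Store.prems show ?case by cases simp
next
  case IH: (Seq c\<^sub>1 s t\<^sub>1 s' c\<^sub>2 t\<^sub>2 s2)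
  from IH.prems show ?case
  proof cases
    case (Seq u\<^sub>1 r u\<^sub>2)
    from IH.IH(1)[OF Seq(2)] have "u\<^sub>1 = t\<^sub>1" "r = s'" by blast+
    with IH.IH(2) Seq show ?thesis by blast
  qed
next
  case (CondTrue a s c\<^sub>1 t s' c\<^sub>2)
  from CondTrue.prems CondTrue.hyps(1) show ?case by cases (use CondTrue.IH in blast)+
next
  case (CondFalse a s c\<^sub>2 t s' c\<^sub>1)
  from CondFalse.prems CondFalse.hyps(1) show ?case by cases (use CondFalse.IH in blast)+
next
  case (WhileFalse a s c)
  from WhileFalse.prems WhileFalse.hyps show ?case by cases blast+
next
  case IH: (WhileTrue a s c t\<^sub>1 s' t\<^sub>2 s2)
  from IH.prems show ?case
  proof cases
    case WhileFalse
    with IH.hyps(1) show ?thesis by blast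
  next
    case (WhileTrue u\<^sub>1 r u\<^sub>2)
    from IH.IH(1)[OF WhileTrue(3)] have "u\<^sub>1 = t\<^sub>1" "r = s'" by blast+
    with IH.IH(2) WhileTrue show ?thesis by blast
  qed
qed

text \<open>The input word occupies memory from address \<open>0\<close> on, with its length in register \<open>0\<close>. On
  halting, register \<open>0\<close> holds the length of the output word and register \<open>1\<close> its address.\<close>

definition ram_input :: "nat list \<Rightarrow> ram_state" where
  "ram_input xs = ((\<lambda>_. 0)(0 := length xs), \<lambda>i. if i < length xs then xs ! i else 0)"

definition ram_output :: "ram_state \<Rightarrow> nat list" where
  "ram_output s = map (snd s) [fst s 1 ..< fst s 1 + fst s 0]"

text \<open>The output length is added to the running time, because a machine could otherwise declare
  an exponentially long block of memory to be its output. The word length is a sensible input size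
  as long as the entries of a code word \<open>code x\<close> are bounded by its length, as is the case for
  \<open>graph_code\<close> below.\<close>

definition poly_time_solvable ::
    "'a set \<Rightarrow> ('a \<Rightarrow> nat list) \<Rightarrow> ('a \<Rightarrow> nat list \<Rightarrow> bool) \<Rightarrow> bool" where
  "poly_time_solvable D code correct \<longleftrightarrow>
     (\<exists>c. \<exists>q :: nat poly. \<forall>x\<in>D. \<exists>t s.
        exec c (ram_input (code x)) t s \<and>
        t + length (ram_output s) \<le> poly q (length (code x)) \<and>
        correct x (ram_output s))"


section \<open>Graphs as inputs, families of vertex sets as outputs\<close>

text \<open>A pair \<open>(n, E)\<close> stands for the graph with vertex set \<open>{..<n}\<close> and edge set \<open>E\<close>. Its code
  is \<open>n\<close> followed by the adjacency matrix, row by row; no geometric representation is supplied.\<close>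

definition graph_code :: "nat \<times> nat set set \<Rightarrow> nat list" where
  "graph_code G = (case G of (n, E) \<Rightarrow>
     n # concat (map (\<lambda>i. map (\<lambda>j. of_bool ({i, j} \<in> E)) [0..<n]) [0..<n]))"

text \<open>A list of subsets of \<open>{..<n}\<close> is output as its length followed by the characteristic vectors
  of its members.\<close>

definition family_code :: "nat \<Rightarrow> nat set list \<Rightarrow> nat list" where
  "family_code n Cs =
     length Cs # concat (map (\<lambda>C. map (\<lambda>v. of_bool (v \<in> C)) [0..<n]) Cs)"

definition enumerates_maximal_cliques :: "nat \<times> nat set set \<Rightarrow> nat list \<Rightarrow> bool" where
  "enumerates_maximal_cliques G ys = (case G of (n, E) \<Rightarrow>
     (\<exists>Cs. distinct Cs \<and> set Cs = {C. maximal_clique {..<n} E C} \<and> ys = family_code n Cs))"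

definition computes_clique_number :: "nat \<times> nat set set \<Rightarrow> nat list \<Rightarrow> bool" where
  "computes_clique_number G ys = (case G of (n, E) \<Rightarrow> ys = [clique_number {..<n} E])"

end

theory Submission imports Defs begin

text \<open>Two unit squares meet iff their coordinates differ by at most 1. A maximal clique is therefore
  the common closed neighbourhood of at most four of its members, those with extreme coordinates.
  Conversely, a common closed neighbourhood of four vertices that is a clique and contains these
  vertices is a maximal clique in any graph. So it suffices to run through all quadruples of vertices
  and to discard repetitions; no geometric representation is needed.\<close>

section \<open>Maximal cliques of unit square graphs\<close>

text \<open>The time bound shapes the development more than the geometry does. Every loop counts up
  to a bound held in a register, and one number \<open>B\<close> dominates all iteration counts, so
  the cost of a program is at most the value at \<open>B\<close> of a polynomial that depends on the
  program text alone. The loops over the stored family are the only ones not bounded by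
  \<open>n\<close>. That family is kept free of repetitions, and each member is the empty set or
  comes from a quadruple, so it never has more than \<open>1 + n ^ 4\<close> members. With input
  length \<open>L = 1 + n * n\<close>, the choice \<open>B = L ^ 2\<close> covers both kinds of
  loop. The machine has neither multiplication nor Boolean operations: row addresses arise by
  repeated addition of \<open>n\<close>, and tests on 0/1 entries become sums and truncated
  differences.\<close>

definition common_nbrs :: "nat \<Rightarrow> (nat \<Rightarrow> nat \<Rightarrow> bool) \<Rightarrow> nat \<Rightarrow> nat \<Rightarrow> nat \<Rightarrow> nat \<Rightarrow> nat set" where
  "common_nbrs n A a b c d = {j. j < n \<and> A a j \<and> A b j \<and> A c j \<and> A d j}"

text \<open>\<open>A\<close> is meant to be reflexive adjacency. The inclusion then says that the
  four vertices are pairwise adjacent; they may coincide, which covers cliques with fewer than four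
  vertices.\<close>

definition spanning :: "nat \<Rightarrow> (nat \<Rightarrow> nat \<Rightarrow> bool) \<Rightarrow> nat \<Rightarrow> nat \<Rightarrow> nat \<Rightarrow> nat \<Rightarrow> bool" where
  "spanning n A a b c d \<longleftrightarrow> {a, b, c, d} \<subseteq> common_nbrs n A a b c d \<and>
     (\<forall>i\<in>common_nbrs n A a b c d. \<forall>j\<in>common_nbrs n A a b c d. A i j)"

definition spanned_set :: "nat \<Rightarrow> (nat \<Rightarrow> nat \<Rightarrow> bool) \<Rightarrow> nat \<Rightarrow> nat \<Rightarrow> nat \<Rightarrow> nat \<Rightarrow> nat set set" where
  "spanned_set n A a b c d = (if spanning n A a b c d then {common_nbrs n A a b c d} else {})"

text \<open>There is no quadruple for \<open>n = 0\<close>, although the empty set is then a maximal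
  clique; hence the extra clause.\<close>

definition spanned_sets :: "nat \<Rightarrow> (nat \<Rightarrow> nat \<Rightarrow> bool) \<Rightarrow> nat set set" where
  "spanned_sets n A = (if n = 0 then {{}} else {}) \<union>
     (\<Union>a<n. \<Union>b<n. \<Union>c<n. \<Union>d<n. spanned_set n A a b c d)"

lemma unit_squares_meet_iff:
  fixes a b a' b' :: real
  shows "cbox (a, b) (a + 1, b + 1) \<inter> cbox (a', b') (a' + 1, b' + 1) \<noteq> {} \<longleftrightarrow>
     \<bar>a - a'\<bar> \<le> 1 \<and> \<bar>b - b'\<bar> \<le> 1"
  (is "?L = ?R")
proof
  assume ?L
  then show ?R by (auto simp: cbox_Pair_eq abs_le_iff)
next
  assume ?R
  \<comment> \<open>The witness is the lower left corner of the intersection of the two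
    squares.\<close>
  then have "(max a a', max b b') \<in> cbox (a, b) (a + 1, b + 1) \<inter> cbox (a', b') (a' + 1, b' + 1)"
    by (auto simp: cbox_Pair_eq max_def)
  then show ?L by blast
qed

lemma unit_square_coordinates:
  assumes "is_2SUIG \<epsilon> V E"
  obtains x y :: "'a \<Rightarrow> real" where
    "\<And>u v. u \<in> V \<Longrightarrow> v \<in> V \<Longrightarrow> u \<noteq> v \<Longrightarrow>
       {u, v} \<in> E \<longleftrightarrow> \<bar>x u - x v\<bar> \<le> 1 \<and> \<bar>y u - y v\<bar> \<le> 1"
proof -
  obtain R where R: "intersection_graph V E R" "\<forall>v\<in>V. height1_rectangle 1 (R v)"
    using assms by (auto simp: is_2SUIG_def two_stab_representation_def)
  then have "\<forall>v\<in>V. \<exists>a b. R v = cbox (a, b) (a + 1, b + 1)"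
    by (auto simp: height1_rectangle_def)
  then obtain x y where xy: "\<And>v. v \<in> V \<Longrightarrow> R v = cbox (x v, y v) (x v + 1, y v + 1)"
    by metis
  show ?thesis
  proof (rule that[of x y])
    fix u v assume "u \<in> V" "v \<in> V" "u \<noteq> v"
    then show "{u, v} \<in> E \<longleftrightarrow> \<bar>x u - x v\<bar> \<le> 1 \<and> \<bar>y u - y v\<bar> \<le> 1"
      using R(1) xy unit_squares_meet_iff[of "x u" "y u" "x v" "y v"]
      by (auto simp: intersection_graph_def)
  qed
qed

text \<open>Subsets of cliques are cliques, so maximality need only be tested against extensions by
  a single vertex.\<close>

lemma maximal_clique_iff_closed:
  assumes A: "\<And>i j. A i j \<longleftrightarrow> i = j \<or> {i, j} \<in> E"
  shows "maximal_clique V E C \<longleftrightarrow> C \<subseteq> V \<and> (\<forall>i\<in>C. \<forall>j\<in>C. A i j) \<and>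
           (\<forall>w\<in>V. (\<forall>i\<in>C. A i w) \<longrightarrow> w \<in> C)"
    (is "?L = ?R")
proof
  assume L: ?L
  have "w \<in> C" if "w \<in> V" "\<forall>i\<in>C. A i w" for w
  proof -
    have "clique V E (insert w C)"
      using L that by (auto simp: maximal_clique_def clique_def A insert_commute)
    then show ?thesis using L by (auto simp: maximal_clique_def)
  qed
  then show ?R using L by (auto simp: maximal_clique_def clique_def A)
next
  assume R: ?R
  have "D = C" if D: "clique V E D" "C \<subseteq> D" for D
  proof -
    have "A i w" if "i \<in> C" "w \<in> D" for i w
      using D that unfolding clique_def A by blast
    moreover have "D \<subseteq> V" using D(1) by (simp add: clique_def)
    ultimately have "D \<subseteq> C" using R by (meson subsetD subsetI)
    then show ?thesis using D(2) by simp
  qed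
  moreover have "clique V E C"
    unfolding clique_def using conjunct1[OF R] conjunct1[OF conjunct2[OF R]] A by metis
  ultimately show ?L unfolding maximal_clique_def by simp
qed

text \<open>If \<open>a\<close>, \<open>b\<close> are the members of a maximal clique with extreme \<open>x\<close>-coordinates and \<open>c\<close>, \<open>d\<close>
  those with extreme \<open>y\<close>-coordinates, then a square meeting all four of them meets every member.\<close>

lemma maximal_clique_spanned:
  fixes x y :: "nat \<Rightarrow> real"
  assumes A: "\<And>i j. A i j \<longleftrightarrow> i = j \<or> {i, j} \<in> E"
    and xy: "\<And>i j. i < n \<Longrightarrow> j < n \<Longrightarrow> A i j \<longleftrightarrow> \<bar>x i - x j\<bar> \<le> 1 \<and> \<bar>y i - y j\<bar> \<le> 1"
    and C: "maximal_clique {..<n} E C" and "C \<noteq> {}"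
  obtains a b c d where "a < n" "b < n" "c < n" "d < n" "spanning n A a b c d"
    "C = common_nbrs n A a b c d"
proof -
  have Cn: "C \<subseteq> {..<n}" and CC: "\<And>i j. i \<in> C \<Longrightarrow> j \<in> C \<Longrightarrow> A i j"
    and Cmax: "\<And>w. w < n \<Longrightarrow> \<forall>i\<in>C. A i w \<Longrightarrow> w \<in> C"
    using C unfolding maximal_clique_iff_closed[OF A] by auto
  have fin: "finite C" using Cn finite_subset by blast
  obtain a where a: "a \<in> C" "\<forall>i\<in>C. x a \<le> x i"
    using Min_in[of "x ` C"] Min_le[of "x ` C"] fin \<open>C \<noteq> {}\<close>
    by (metis (no_types, lifting) finite_imageI image_iff image_is_empty)
  obtain b where b: "b \<in> C" "\<forall>i\<in>C. x i \<le> x b"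
    using Max_in[of "x ` C"] Max_ge[of "x ` C"] fin \<open>C \<noteq> {}\<close>
    by (metis (no_types, lifting) finite_imageI image_iff image_is_empty)
  obtain c where c: "c \<in> C" "\<forall>i\<in>C. y c \<le> y i"
    using Min_in[of "y ` C"] Min_le[of "y ` C"] fin \<open>C \<noteq> {}\<close>
    by (metis (no_types, lifting) finite_imageI image_iff image_is_empty)
  obtain d where d: "d \<in> C" "\<forall>i\<in>C. y i \<le> y d"
    using Max_in[of "y ` C"] Max_ge[of "y ` C"] fin \<open>C \<noteq> {}\<close>
    by (metis (no_types, lifting) finite_imageI image_iff image_is_empty)
  have lt: "a < n" "b < n" "c < n" "d < n" using a b c d Cn by auto
  \<comment> \<open>Meeting \<open>a\<close> and \<open>b\<close> forces
    \<open>x b - 1 \<le> x w \<le> x a + 1\<close>, and each \<open>x i\<close> lies between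
    \<open>x a\<close> and \<open>x b\<close>, so \<open>x w\<close> and \<open>x i\<close> differ
    by at most 1. The vertices \<open>c\<close> and \<open>d\<close> do the same for
    \<open>y\<close>.\<close>
  have "w \<in> C" if "w < n" "A a w" "A b w" "A c w" "A d w" for w
  proof (rule Cmax[OF \<open>w < n\<close>], rule)
    fix i assume i: "i \<in> C"
    have "x a \<le> x i" "x i \<le> x b" "y c \<le> y i" "y i \<le> y d" using a b c d i by auto
    moreover have "i < n" using i Cn by auto
    ultimately show "A i w" using that lt by (auto simp: xy abs_le_iff)
  qed
  then have eq: "C = common_nbrs n A a b c d"
    using Cn CC a(1) b(1) c(1) d(1) by (auto simp: common_nbrs_def)
  then have "spanning n A a b c d"
    unfolding spanning_def eq[symmetric] using a(1) b(1) c(1) d(1) CC by auto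
  then show ?thesis using that[OF lt] eq by blast
qed

lemma maximal_cliques_eq_spanned_sets:
  assumes A: "\<And>i j. A i j \<longleftrightarrow> i = j \<or> {i, j} \<in> E" and G: "is_2SUIG \<epsilon> {..<n} E"
  shows "{C. maximal_clique {..<n} E C} = spanned_sets n A"
proof (intro equalityI subsetI)
  fix C assume "C \<in> {C. maximal_clique {..<n} E C}"
  then have C: "maximal_clique {..<n} E C" by simp
  obtain x y :: "nat \<Rightarrow> real" where xy: "\<And>i j. i \<in> {..<n} \<Longrightarrow> j \<in> {..<n} \<Longrightarrow> i \<noteq> j \<Longrightarrow>
       {i, j} \<in> E \<longleftrightarrow> \<bar>x i - x j\<bar> \<le> 1 \<and> \<bar>y i - y j\<bar> \<le> 1"
    by (rule unit_square_coordinates[OF G]) blast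
  have xy': "A i j \<longleftrightarrow> \<bar>x i - x j\<bar> \<le> 1 \<and> \<bar>y i - y j\<bar> \<le> 1" if "i < n" "j < n" for i j
    using xy[of i j] that by (cases "i = j") (auto simp: A)
  show "C \<in> spanned_sets n A"
  proof (cases "C = {}")
    case True
    \<comment> \<open>Every vertex is vacuously adjacent to all members of the empty set, so
      closedness leaves no vertex outside it.\<close>
    then have "n = 0"
      using C unfolding maximal_clique_iff_closed[OF A] by (cases n) auto
    then show ?thesis using True by (simp add: spanned_sets_def)
  next
    case False
    obtain a b c d where "a < n" "b < n" "c < n" "d < n" "spanning n A a b c d"
      "C = common_nbrs n A a b c d"
      by (rule maximal_clique_spanned[OF A xy' C False])
    then show ?thesis unfolding spanned_sets_def spanned_set_def by auto
  qed
next
  fix C assume "C \<in> spanned_sets n A"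
  then consider "n = 0" "C = {}" |
    a b c d where "spanning n A a b c d" "C = common_nbrs n A a b c d"
    by (auto simp: spanned_sets_def spanned_set_def split: if_splits)
  then show "C \<in> {C. maximal_clique {..<n} E C}"
  proof cases
    case 1
    then show ?thesis by (auto simp: maximal_clique_iff_closed[OF A])
  next
    case 2
    \<comment> \<open>A vertex adjacent to all of \<open>C\<close> is adjacent to the spanning
      quadruple, which lies in \<open>C\<close>, and so belongs to its common neighbourhood.\<close>
    have "w \<in> C" if "w < n" "\<forall>i\<in>C. A i w" for w
    proof -
      have "A a w" "A b w" "A c w" "A d w" using 2 that(2) by (simp_all add: spanning_def)
      then show ?thesis using 2(2) \<open>w < n\<close> by (simp add: common_nbrs_def)
    qed
    moreover have "C \<subseteq> {..<n}" using 2(2) by (auto simp: common_nbrs_def)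
    ultimately show ?thesis
      unfolding mem_Collect_eq maximal_clique_iff_closed[OF A]
      using 2 by (simp add: spanning_def)
  qed
qed

text \<open>Finiteness extends every clique to a maximal one, so only maximal cliques need
  inspection. The case \<open>m = 0\<close> matches the start value of a running maximum and is
  attained by the empty clique.\<close>

lemma clique_number_eqI:
  assumes fin: "finite V"
    and ub: "\<And>C. maximal_clique V E C \<Longrightarrow> card C \<le> m"
    and att: "m = 0 \<or> (\<exists>C. maximal_clique V E C \<and> card C = m)"
  shows "clique_number V E = m"
  unfolding clique_number_def
proof (rule Max_eqI)
  have sub: "{C. clique V E C} \<subseteq> Pow V" by (auto simp: clique_def)
  then show "finite (card ` {C. clique V E C})"
    using fin finite_subset by blast
  show "k \<le> m" if "k \<in> card ` {C. clique V E C}" for k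
  proof -
    obtain C where C: "clique V E C" "k = card C" using \<open>k \<in> _\<close> by blast
    obtain D where D: "D \<in> {C. clique V E C}" "C \<subseteq> D"
        and mx: "\<forall>D'\<in>{C. clique V E C}. D \<subseteq> D' \<longrightarrow> D = D'"
      using finite_has_maximal2[of "{C. clique V E C}" C] C sub fin
      by (metis finite_Pow_iff finite_subset mem_Collect_eq)
    have "card C \<le> card D" using D sub fin by (meson Pow_iff card_mono finite_subset subsetD)
    moreover have "maximal_clique V E D" using D mx by (auto simp: maximal_clique_def)
    ultimately show ?thesis using ub C by fastforce
  qed
  have "clique V E {}" by (simp add: clique_def)
  then show "m \<in> card ` {C. clique V E C}"
    using att by (force simp: maximal_clique_def)
qed


section \<open>Verification of RAM programs with bounded loops\<close>

text \<open>The static bound \<open>time_poly c\<close> is a polynomial in a common bound on the numbers of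
  iterations of all loops of \<open>c\<close>.\<close>

primrec time_poly :: "com \<Rightarrow> nat poly" where
  "time_poly Skip = [:1:]"
| "time_poly (Assign r a) = [:1 + acost a:]"
| "time_poly (Store a b) = [:1 + acost a + acost b:]"
| "time_poly (Seq c d) = 1 + time_poly c + time_poly d"
| "time_poly (Cond a c d) = [:1 + acost a:] + time_poly c + time_poly d"
| "time_poly (While a c) = [:1 + acost a:] + [:0, 1:] * ([:1 + acost a:] + time_poly c)"

text \<open>A total correctness assertion that joins termination, running time and postcondition;
  the time is measured by the static bound, so proofs about programs never count steps.\<close>

definition runs :: "nat \<Rightarrow> com \<Rightarrow> (nat \<Rightarrow> nat) \<Rightarrow> (nat \<Rightarrow> nat) \<Rightarrow>
    ((nat \<Rightarrow> nat) \<Rightarrow> (nat \<Rightarrow> nat) \<Rightarrow> bool) \<Rightarrow> bool" where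
  "runs B c r M Q \<longleftrightarrow> (\<exists>t r' M'. exec c (r, M) t (r', M') \<and> t \<le> poly (time_poly c) B \<and> Q r' M')"

lemma runs_mono:
  assumes "runs B c r M Q" "\<And>r' M'. Q r' M' \<Longrightarrow> Q' r' M'"
  shows "runs B c r M Q'"
  using assms unfolding runs_def by blast

lemma runs_Skip: "Q r M \<Longrightarrow> runs B Skip r M Q"
  unfolding runs_def using exec.Skip by fastforce

lemma runs_Assign: "Q (r(x := aval a (r, M))) M \<Longrightarrow> runs B (Assign x a) r M Q"
  unfolding runs_def using exec.Assign[of x a "(r, M)"] by fastforce

lemma runs_Store: "Q r (M(aval a (r, M) := aval b (r, M))) \<Longrightarrow> runs B (Store a b) r M Q"
  unfolding runs_def using exec.Store[of a b "(r, M)"] by fastforce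

text \<open>Nesting the second assertion in the first postcondition gives backward reasoning without
  naming intermediate states.\<close>

lemma runs_Seq:
  assumes "runs B c r M (\<lambda>r' M'. runs B d r' M' Q)"
  shows "runs B (Seq c d) r M Q"
proof -
  obtain t r' M' u r2 M2 where "exec c (r, M) t (r', M')" "t \<le> poly (time_poly c) B"
    "exec d (r', M') u (r2, M2)" "u \<le> poly (time_poly d) B" "Q r2 M2"
    using assms unfolding runs_def by blast
  then have "exec (Seq c d) (r, M) (1 + t + u) (r2, M2) \<and>
      1 + t + u \<le> poly (time_poly (Seq c d)) B \<and> Q r2 M2"
    using exec.Seq by fastforce
  then show ?thesis unfolding runs_def by blast
qed

lemma runs_Cond:
  assumes "aval a (r, M) \<noteq> 0 \<Longrightarrow> runs B c r M Q" "aval a (r, M) = 0 \<Longrightarrow> runs B d r M Q"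
  shows "runs B (Cond a c d) r M Q"
proof (cases "aval a (r, M) = 0")
  case True
  then obtain t r' M' where "exec d (r, M) t (r', M')" "t \<le> poly (time_poly d) B" "Q r' M'"
    using assms unfolding runs_def by blast
  then have "exec (Cond a c d) (r, M) (1 + acost a + t) (r', M') \<and>
      1 + acost a + t \<le> poly (time_poly (Cond a c d)) B \<and> Q r' M'"
    using exec.CondFalse True by fastforce
  then show ?thesis unfolding runs_def by blast
next
  case False
  then obtain t r' M' where "exec c (r, M) t (r', M')" "t \<le> poly (time_poly c) B" "Q r' M'"
    using assms unfolding runs_def by blast
  then have "exec (Cond a c d) (r, M) (1 + acost a + t) (r', M') \<and>
      1 + acost a + t \<le> poly (time_poly (Cond a c d)) B \<and> Q r' M'"
    using exec.CondTrue False by fastforce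
  then show ?thesis unfolding runs_def by blast
qed

text \<open>Since subtraction is truncated, the guard is nonzero exactly while register
  \<open>x\<close> is below register \<open>b\<close>.\<close>

definition For :: "nat \<Rightarrow> nat \<Rightarrow> com \<Rightarrow> com" where
  "For x b c = Seq (Assign x (Const 0))
     (While (Sub (Reg b) (Reg x)) (Seq c (Assign x (Add (Reg x) (Const 1)))))"

text \<open>Induction on the remaining rounds \<open>N - k\<close>. Each round pays for one test and
  one body; the leading summand pays for the final failing test.\<close>

lemma While_iterate:
  assumes step: "\<And>k r M. I k r M \<Longrightarrow> k < N \<Longrightarrow>
        aval a (r, M) \<noteq> 0 \<and> runs B c r M (I (Suc k))"
    and stop: "\<And>r M. I N r M \<Longrightarrow> aval a (r, M) = 0"
    and "I k r M" "k \<le> N"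
  shows "\<exists>t r' M'. exec (While a c) (r, M) t (r', M') \<and>
      t \<le> 1 + acost a + (N - k) * (1 + acost a + poly (time_poly c) B) \<and> I N r' M'"
  using assms(3,4)
proof (induction "N - k" arbitrary: k r M)
  case 0
  then have "I N r M" by simp
  then show ?case
    using exec.WhileFalse[of a "(r, M)" c] stop by (intro exI conjI) auto
next
  case (Suc m)
  then have "k < N" by simp
  then obtain t r' M' where 1: "aval a (r, M) \<noteq> 0" "exec c (r, M) t (r', M')"
      "t \<le> poly (time_poly c) B" "I (Suc k) r' M'"
    using step[OF Suc.prems(1)] unfolding runs_def by blast
  obtain u r2 M2 where 2: "exec (While a c) (r', M') u (r2, M2)" "I N r2 M2"
      "u \<le> 1 + acost a + (N - Suc k) * (1 + acost a + poly (time_poly c) B)"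
    using Suc.hyps(1)[OF _ 1(4)] Suc.hyps(2) \<open>k < N\<close> by fastforce
  have "N - k = Suc (N - Suc k)" using \<open>k < N\<close> by simp
  then have "1 + acost a + t + u \<le>
      1 + acost a + (N - k) * (1 + acost a + poly (time_poly c) B)"
    using 1(3) 2(3) by simp
  then show ?case using exec.WhileTrue[OF 1(1,2) 2(1)] 2(2) by blast
qed

text \<open>The body must leave counter and bound intact, and it establishes the invariant for the
  state in which the counter is already advanced, because the increment belongs to the loop.\<close>

lemma runs_For:
  assumes init: "I 0 (r(x := 0)) M"
    and body: "\<And>k r M. I k r M \<Longrightarrow> r x = k \<Longrightarrow> r b = N \<Longrightarrow> k < N \<Longrightarrow>
      runs B c r M (\<lambda>r' M'. r' x = k \<and> r' b = N \<and> I (Suc k) (r'(x := Suc k)) M')"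
    and final: "\<And>r M. I N r M \<Longrightarrow> r x = N \<Longrightarrow> r b = N \<Longrightarrow> Q r M"
    and "r b = N" "x \<noteq> b" "N \<le> B"
  shows "runs B (For x b c) r M Q"
proof -
  let ?a = "Sub (Reg b) (Reg x)"
  let ?c = "Seq c (Assign x (Add (Reg x) (Const 1)))"
  let ?J = "\<lambda>k r M. I k r M \<and> r x = k \<and> r b = N"
  have "\<exists>t r' M'. exec (While ?a ?c) (r(x := 0), M) t (r', M') \<and>
      t \<le> 1 + acost ?a + (N - 0) * (1 + acost ?a + poly (time_poly ?c) B) \<and> ?J N r' M'"
  proof (rule While_iterate[where I = ?J])
    fix k r M assume J: "?J k r M" "k < N"
    have "runs B ?c r M (?J (Suc k))"
      by (rule runs_Seq, rule runs_mono[OF body[of k]], use J in simp_all)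
        (rule runs_Assign, use \<open>x \<noteq> b\<close> in simp)
    then show "aval ?a (r, M) \<noteq> 0 \<and> runs B ?c r M (?J (Suc k))"
      using J by simp
  qed (use init assms in auto)
  then obtain t r' M' where t: "exec (While ?a ?c) (r(x := 0), M) t (r', M')" "?J N r' M'"
    "t \<le> 1 + acost ?a + N * (1 + acost ?a + poly (time_poly ?c) B)" by auto
  note t(3)
  also have "\<dots> \<le> 1 + acost ?a + B * (1 + acost ?a + poly (time_poly ?c) B)"
    using \<open>N \<le> B\<close> by (intro add_left_mono mult_right_mono) auto
  also have "\<dots> = poly (time_poly (While ?a ?c)) B" by simp
  finally have "runs B (While ?a ?c) (r(x := 0)) M Q"
    unfolding runs_def using t(1,2) final by blast
  then show ?thesis unfolding For_def by (intro runs_Seq runs_Assign) simp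
qed

lemmas runs_intros = runs_Skip runs_Assign runs_Store runs_Seq


section \<open>Row-major arrays\<close>

lemma row_index_less:
  fixes i :: nat
  assumes "i < m" "j < n"
  shows "i * n + j < m * n"
proof -
  have "i * n + j < Suc i * n" using assms by simp
  also have "\<dots> \<le> m * n" using assms by (intro mult_right_mono) auto
  finally show ?thesis .
qed

lemma row_index_inject:
  fixes i :: nat
  assumes "j < n" "j' < n"
  shows "i * n + j = i' * n + j' \<longleftrightarrow> i = i' \<and> j = j'"
proof
  assume eq: "i * n + j = i' * n + j'"
  have "(i * n + j) div n = i" "(i' * n + j') div n = i'" using assms by auto
  then show "i = i' \<and> j = j'" using eq by simp
qed auto

lemma length_concat_rows: "length (concat (map (\<lambda>x. map (f x) [0..<n]) xs)) = length xs * n"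
  by (induction xs) auto

lemma nth_concat_rows:
  assumes "i < length xs" "j < n"
  shows "concat (map (\<lambda>x. map (f x) [0..<n]) xs) ! (i * n + j) = f (xs ! i) j"
  using assms
proof (induction xs arbitrary: i)
  case (Cons x xs)
  then show ?case by (cases i) (auto simp: nth_append)
qed simp

lemma length_graph_code: "length (graph_code (n, E)) = 1 + n * n"
  by (simp add: graph_code_def length_concat_rows)

lemma nth_graph_code:
  assumes "i < n" "j < n"
  shows "graph_code (n, E) ! (1 + i * n + j) = of_bool ({i, j} \<in> E)"
  using nth_concat_rows[of i "[0..<n]" j n "\<lambda>i j. of_bool ({i, j} \<in> E)"] assms
  by (simp add: graph_code_def)

definition stores_family :: "nat \<Rightarrow> nat \<Rightarrow> nat set list \<Rightarrow> (nat \<Rightarrow> nat) \<Rightarrow> bool" where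
  "stores_family n p Cs M \<longleftrightarrow> (\<forall>k<length Cs. \<forall>j<n. M (p + k * n + j) = of_bool (j \<in> Cs ! k))"

lemma family_code_eq:
  assumes "M p = length Cs" "stores_family n (p + 1) Cs M"
  shows "map M [p..<p + (1 + length Cs * n)] = family_code n Cs"
proof -
  let ?f = "\<lambda>C v. of_bool (v \<in> C) :: nat"
  have "map M [p + 1..<p + 1 + length Cs * n] = concat (map (\<lambda>C. map (?f C) [0..<n]) Cs)"
  proof (rule nth_equalityI)
    fix i assume "i < length (map M [p + 1..<p + 1 + length Cs * n])"
    then have i: "i < length Cs * n" by (simp del: upt_Suc)
    then have n: "0 < n" by (cases n) auto
    have "i div n < length Cs" "i mod n < n"
      using i n by (auto simp: less_mult_imp_div_less)
    moreover have idx: "i div n * n + i mod n = i" by simp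
    ultimately have "M (p + 1 + i) = of_bool (i mod n \<in> Cs ! (i div n))"
      using assms(2) unfolding stores_family_def by (metis add.assoc)
    moreover have "concat (map (\<lambda>C. map (?f C) [0..<n]) Cs) ! i = ?f (Cs ! (i div n)) (i mod n)"
      using nth_concat_rows[of "i div n" Cs "i mod n" n ?f] \<open>i div n < _\<close> \<open>i mod n < n\<close> idx by metis
    ultimately show "map M [p + 1..<p + 1 + length Cs * n] ! i =
        concat (map (\<lambda>C. map (?f C) [0..<n]) Cs) ! i"
      using i by (simp del: upt_Suc)
  qed (simp add: length_concat_rows del: upt_Suc)
  moreover have "[p..<p + (1 + length Cs * n)] = p # [p + 1..<p + 1 + length Cs * n]"
    by (simp add: upt_conv_Cons del: upt_Suc)
  ultimately show ?thesis using assms(1) by (simp add: family_code_def)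
qed


section \<open>The enumeration program\<close>

text \<open>Register 0 holds the input length \<open>L\<close>, register 2 the number \<open>n\<close> of vertices, and registers
  3 to 6 hold the four vertices under consideration. The cell at \<open>L + i\<close> is the address of row \<open>i\<close>
  of the matrix, the output starts at \<open>L + n\<close> (register 1), the sets found so far are counted in
  register 9 and register 8 points behind them.\<close>

abbreviation cell :: "nat \<Rightarrow> nat \<Rightarrow> aexp" where
  "cell p j \<equiv> Load (Add (Reg p) (Reg j))"

abbreviation entry :: "nat \<Rightarrow> nat \<Rightarrow> aexp" where
  "entry i j \<equiv> Load (Add (cell 0 i) (Reg j))"

text \<open>With the diagonal set to 1, the matrix describes closed neighbourhoods. The empty graph has
  the empty set as its only maximal clique, hence the initial count \<open>1 - n\<close>.\<close>

definition prepare :: com where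
  "prepare = Seq (Assign 2 (Load (Const 0))) (Seq (Assign 8 (Const 1))
     (Seq (For 10 2 (Seq (Store (Add (Reg 0) (Reg 10)) (Reg 8))
        (Seq (Store (Add (Reg 8) (Reg 10)) (Const 1)) (Assign 8 (Add (Reg 8) (Reg 2))))))
     (Seq (Assign 1 (Add (Reg 0) (Reg 2))) (Seq (Assign 8 (Add (Reg 1) (Const 1)))
        (Assign 9 (Sub (Const 1) (Reg 2)))))))"

text \<open>A sum of four 0/1 entries minus 3, truncated, is their conjunction. The row is written
  tentatively, directly behind the stored family.\<close>

definition write_common_nbrs :: com where
  "write_common_nbrs = For 11 2 (Store (Add (Reg 8) (Reg 11))
     (Sub (Add (Add (entry 3 11) (entry 4 11)) (Add (entry 5 11) (entry 6 11))) (Const 3)))"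

text \<open>The start value is 1 iff all four entries are 1. The amount subtracted for a pair is 1
  iff both vertices are in the set but not adjacent; truncation keeps a verdict of 0 at 0.\<close>

definition test_spanning :: com where
  "test_spanning = Seq
     (Assign 12 (Sub (Const 1) (Sub (Const 4) (Add (Add (cell 8 3) (cell 8 4)) (Add (cell 8 5) (cell 8 6))))))
     (For 10 2 (For 11 2 (Assign 12
        (Sub (Reg 12) (Sub (Add (cell 8 10) (cell 8 11)) (Add (entry 10 11) (Const 1)))))))"

text \<open>The two truncated differences add up to the absolute difference of two entries, so
  register 15 stays 1 iff the rows agree. Register 14 walks from row to row in steps of
  \<open>n\<close>.\<close>

definition test_new :: com where
  "test_new = Seq (Assign 14 (Add (Reg 1) (Const 1))) (For 13 9
     (Seq (Assign 15 (Const 1))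
     (Seq (For 11 2 (Assign 15
        (Sub (Reg 15) (Add (Sub (cell 8 11) (cell 14 11)) (Sub (cell 14 11) (cell 8 11))))))
     (Seq (Assign 12 (Sub (Reg 12) (Reg 15))) (Assign 14 (Add (Reg 14) (Reg 2)))))))"

text \<open>Accepting the tentative row only means moving the end pointer behind it and counting it;
  a rejected row is overwritten by the next one.\<close>

definition visit :: com where
  "visit = Seq write_common_nbrs (Seq test_spanning (Seq test_new
     (Cond (Reg 12) (Seq (Assign 8 (Add (Reg 8) (Reg 2))) (Assign 9 (Add (Reg 9) (Const 1)))) Skip)))"

definition enumerate_all :: com where
  "enumerate_all = Seq prepare (For 3 2 (For 4 2 (For 5 2 (For 6 2 visit))))"

text \<open>The length header is stored in front of the rows only now, when the count is final. The
  difference of registers 8 and 1 is the header cell plus all rows.\<close>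

definition output_cliques :: com where
  "output_cliques = Seq enumerate_all (Seq (Store (Reg 1) (Reg 9)) (Assign 0 (Sub (Reg 8) (Reg 1))))"

text \<open>With truncated subtraction, \<open>a + (b - a)\<close> is the maximum of
  \<open>a\<close> and \<open>b\<close>.\<close>

definition output_clique_number :: com where
  "output_clique_number = Seq enumerate_all (Seq (Assign 16 (Const 0))
     (Seq (Assign 14 (Add (Reg 1) (Const 1)))
     (Seq (For 13 9 (Seq (Assign 15 (Const 0))
        (Seq (For 11 2 (Assign 15 (Add (Reg 15) (cell 14 11))))
        (Seq (Assign 16 (Add (Reg 16) (Sub (Reg 15) (Reg 16)))) (Assign 14 (Add (Reg 14) (Reg 2)))))))
     (Seq (Store (Const 0) (Reg 16)) (Seq (Assign 0 (Const 1)) (Assign 1 (Const 0)))))))"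

text \<open>The inequality keeps all rows below address \<open>L\<close>, hence disjoint from the
  row pointers and from the output area.\<close>

definition stores_matrix :: "nat \<Rightarrow> (nat \<Rightarrow> nat \<Rightarrow> bool) \<Rightarrow> nat \<Rightarrow> (nat \<Rightarrow> nat) \<Rightarrow> bool" where
  "stores_matrix n A L M \<longleftrightarrow>
     (\<forall>i<n. M (L + i) + n \<le> L \<and> (\<forall>j<n. M (M (L + i) + j) = of_bool (A i j)))"

lemma stores_matrix_cong:
  assumes "stores_matrix n A L M" "\<And>x. x < L + n \<Longrightarrow> M' x = M x"
  shows "stores_matrix n A L M'"
  unfolding stores_matrix_def
proof (intro allI impI conjI)
  fix i assume i: "i < n"
  then have *: "M' (L + i) = M (L + i)" using assms(2) by simp
  then show "M' (L + i) + n \<le> L" using assms(1) i by (simp add: stores_matrix_def)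
  fix j assume "j < n"
  then show "M' (M' (L + i) + j) = of_bool (A i j)"
    using assms(1) i * assms(2)[of "M (L + i) + j"] by (fastforce simp: stores_matrix_def)
qed

section \<open>Correctness of the passes made for one quadruple\<close>

lemma runs_write_common_nbrs:
  assumes "stores_matrix n A L M" "r 0 = L" "r 2 = n" "L + n \<le> r 8"
    "r 3 < n" "r 4 < n" "r 5 < n" "r 6 < n" "n \<le> B"
  shows "runs B write_common_nbrs r M (\<lambda>r' M'. (\<forall>q. q \<noteq> 11 \<longrightarrow> r' q = r q) \<and>
      (\<forall>x<r 8. M' x = M x) \<and>
      (\<forall>j<n. M' (r 8 + j) = of_bool (j \<in> common_nbrs n A (r 3) (r 4) (r 5) (r 6))))"
  unfolding write_common_nbrs_def
proof (rule runs_For[where N = n and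
      I = "\<lambda>k r' M'. (\<forall>q. q \<noteq> 11 \<longrightarrow> r' q = r q) \<and> (\<forall>x<r 8. M' x = M x) \<and>
      (\<forall>j<k. M' (r 8 + j) = of_bool (j \<in> common_nbrs n A (r 3) (r 4) (r 5) (r 6)))"])
  fix k r' M'
  assume I: "(\<forall>q. q \<noteq> 11 \<longrightarrow> r' q = r q) \<and> (\<forall>x<r 8. M' x = M x) \<and>
      (\<forall>j<k. M' (r 8 + j) = of_bool (j \<in> common_nbrs n A (r 3) (r 4) (r 5) (r 6)))"
    and k: "r' 11 = k" "k < n"
  have "stores_matrix n A L M'" using stores_matrix_cong[OF assms(1)] I assms(4) by simp
  then have e: "M' (M' (L + i) + k) = of_bool (A i k)" if "i < n" for i
    using that k by (simp add: stores_matrix_def)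
  show "runs B (Store (Add (Reg 8) (Reg 11))
      (Sub (Add (Add (entry 3 11) (entry 4 11)) (Add (entry 5 11) (entry 6 11))) (Const 3))) r' M'
     (\<lambda>r2 M2. r2 11 = k \<and> r2 2 = n \<and> (\<forall>q. q \<noteq> 11 \<longrightarrow> (r2(11 := Suc k)) q = r q) \<and>
      (\<forall>x<r 8. M2 x = M x) \<and>
      (\<forall>j<Suc k. M2 (r 8 + j) = of_bool (j \<in> common_nbrs n A (r 3) (r 4) (r 5) (r 6))))"
    by (rule runs_Store) (use I k e assms in \<open>auto simp: less_Suc_eq common_nbrs_def\<close>)
qed (use assms in auto)

lemma runs_test_spanning:
  assumes "stores_matrix n A L M" "r 0 = L" "r 2 = n"
    "r 3 < n" "r 4 < n" "r 5 < n" "r 6 < n" "n \<le> B"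
    and S: "\<And>j. j < n \<Longrightarrow> M (r 8 + j) = of_bool (j \<in> common_nbrs n A (r 3) (r 4) (r 5) (r 6))"
  shows "runs B test_spanning r M (\<lambda>r' M'. (\<forall>q. q \<noteq> 10 \<and> q \<noteq> 11 \<and> q \<noteq> 12 \<longrightarrow> r' q = r q) \<and>
      M' = M \<and> r' 12 = of_bool (spanning n A (r 3) (r 4) (r 5) (r 6)))"
proof -
  let ?S = "common_nbrs n A (r 3) (r 4) (r 5) (r 6)"
  let ?P = "{r 3, r 4, r 5, r 6} \<subseteq> ?S"
  let ?J = "\<lambda>k r' M'. (\<forall>q. q \<noteq> 10 \<and> q \<noteq> 11 \<and> q \<noteq> 12 \<longrightarrow> r' q = r q) \<and> M' = M \<and>
      r' 12 = of_bool (?P \<and> (\<forall>i<k. \<forall>j<n. i \<in> ?S \<and> j \<in> ?S \<longrightarrow> A i j))"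
  have *: "?P \<and> (\<forall>i<n. \<forall>j<n. i \<in> ?S \<and> j \<in> ?S \<longrightarrow> A i j) \<longleftrightarrow>
      spanning n A (r 3) (r 4) (r 5) (r 6)"
    unfolding spanning_def by (auto simp: common_nbrs_def)
  have e: "M (M (L + i) + k) = of_bool (A i k)" if "i < n" "k < n" for i k
    using assms(1) that by (simp add: stores_matrix_def)
  show ?thesis unfolding test_spanning_def
  proof (rule runs_Seq, rule runs_Assign, rule runs_For[where N = n and I = ?J])
    show "?J 0 ((r(12 := aval (Sub (Const 1) (Sub (Const 4)
        (Add (Add (cell 8 3) (cell 8 4)) (Add (cell 8 5) (cell 8 6))))) (r, M)))(10 := 0)) M"
      using assms(2-8) S by auto
    fix k r' M'
    assume J: "?J k r' M'" and k: "r' 10 = k" "k < n"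
    let ?Q = "?P \<and> (\<forall>i<k. \<forall>j<n. i \<in> ?S \<and> j \<in> ?S \<longrightarrow> A i j)"
    show "runs B (For 11 2 (Assign 12
        (Sub (Reg 12) (Sub (Add (cell 8 10) (cell 8 11)) (Add (entry 10 11) (Const 1)))))) r' M'
       (\<lambda>r2 M2. r2 10 = k \<and> r2 2 = n \<and> ?J (Suc k) (r2(10 := Suc k)) M2)"
    proof (rule runs_For[where N = n and I = "\<lambda>m r' M'. r' 10 = k \<and>
        (\<forall>q. q \<noteq> 10 \<and> q \<noteq> 11 \<and> q \<noteq> 12 \<longrightarrow> r' q = r q) \<and> M' = M \<and>
        r' 12 = of_bool (?Q \<and> (\<forall>j<m. k \<in> ?S \<and> j \<in> ?S \<longrightarrow> A k j))"])
      fix m r2 M2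
      assume I: "r2 10 = k \<and> (\<forall>q. q \<noteq> 10 \<and> q \<noteq> 11 \<and> q \<noteq> 12 \<longrightarrow> r2 q = r q) \<and> M2 = M \<and>
        r2 12 = of_bool (?Q \<and> (\<forall>j<m. k \<in> ?S \<and> j \<in> ?S \<longrightarrow> A k j))"
        and m: "r2 11 = m" "m < n"
      show "runs B (Assign 12
        (Sub (Reg 12) (Sub (Add (cell 8 10) (cell 8 11)) (Add (entry 10 11) (Const 1))))) r2 M2
        (\<lambda>r3 M3. r3 11 = m \<and> r3 2 = n \<and> (r3(11 := Suc m)) 10 = k \<and>
          (\<forall>q. q \<noteq> 10 \<and> q \<noteq> 11 \<and> q \<noteq> 12 \<longrightarrow> (r3(11 := Suc m)) q = r q) \<and> M3 = M \<and>
          (r3(11 := Suc m)) 12 = of_bool (?Q \<and> (\<forall>j<Suc m. k \<in> ?S \<and> j \<in> ?S \<longrightarrow> A k j)))"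
        by (rule runs_Assign) (use I m k e[of k m] S[of k] S[of m] assms(2,3) in
            \<open>auto simp: less_Suc_eq\<close>)
    qed (use J k assms in \<open>auto simp: less_Suc_eq\<close>)
  qed (use assms * in auto)
qed

lemma runs_test_new:
  assumes "r 1 = p" "r 2 = n" "r 9 = length Cs" "n \<le> B" "length Cs \<le> B"
    and Cs: "stores_family n (p + 1) Cs M" "\<And>C. C \<in> set Cs \<Longrightarrow> C \<subseteq> {..<n}"
    and S: "S \<subseteq> {..<n}" "\<And>j. j < n \<Longrightarrow> M (r 8 + j) = of_bool (j \<in> S)"
    and P: "r 12 = of_bool P"
  shows "runs B test_new r M (\<lambda>r' M'. (\<forall>q. q < 11 \<longrightarrow> r' q = r q) \<and>
      M' = M \<and> r' 12 = of_bool (P \<and> S \<notin> set Cs))"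
proof -
  let ?J = "\<lambda>k r' M'. (\<forall>q. q < 11 \<longrightarrow> r' q = r q) \<and> M' = M \<and>
      r' 14 = p + 1 + k * n \<and> r' 12 = of_bool (P \<and> (\<forall>i<k. S \<noteq> Cs ! i))"
  show ?thesis unfolding test_new_def
  proof (rule runs_Seq, rule runs_Assign, rule runs_For[where N = "length Cs" and I = ?J])
    fix k r' M'
    assume J: "?J k r' M'" and k: "r' 13 = k" "k < length Cs"
    \<comment> \<open>Comparing characteristic vectors decides equality because both sets lie in
      \<open>{..<n}\<close>.\<close>
    have eq: "S = Cs ! k \<longleftrightarrow> (\<forall>j<n. j \<in> S \<longleftrightarrow> j \<in> Cs ! k)"
      using S(1) Cs(2)[of "Cs ! k"] k(2) by auto
    have e: "M (p + 1 + k * n + j) = of_bool (j \<in> Cs ! k)" if "j < n" for j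
      using Cs(1) k that by (simp add: stores_family_def)
    show "runs B (Seq (Assign 15 (Const 1))
     (Seq (For 11 2 (Assign 15
        (Sub (Reg 15) (Add (Sub (cell 8 11) (cell 14 11)) (Sub (cell 14 11) (cell 8 11))))))
     (Seq (Assign 12 (Sub (Reg 12) (Reg 15))) (Assign 14 (Add (Reg 14) (Reg 2)))))) r' M'
      (\<lambda>r2 M2. r2 13 = k \<and> r2 9 = length Cs \<and> ?J (Suc k) (r2(13 := Suc k)) M2)"
    proof (rule runs_Seq, rule runs_Assign, rule runs_Seq, rule runs_For[where N = n and
        I = "\<lambda>m r2 M2. (\<forall>q. q < 11 \<or> 11 < q \<and> q < 15 \<longrightarrow> r2 q = r' q) \<and> M2 = M \<and>
          r2 15 = of_bool (\<forall>j<m. j \<in> S \<longleftrightarrow> j \<in> Cs ! k)"])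
      fix m r2 M2
      assume I: "(\<forall>q. q < 11 \<or> 11 < q \<and> q < 15 \<longrightarrow> r2 q = r' q) \<and> M2 = M \<and>
          r2 15 = of_bool (\<forall>j<m. j \<in> S \<longleftrightarrow> j \<in> Cs ! k)"
        and m: "r2 11 = m" "m < n"
      show "runs B (Assign 15
         (Sub (Reg 15) (Add (Sub (cell 8 11) (cell 14 11)) (Sub (cell 14 11) (cell 8 11))))) r2 M2
        (\<lambda>r3 M3. r3 11 = m \<and> r3 2 = n \<and>
          (\<forall>q. q < 11 \<or> 11 < q \<and> q < 15 \<longrightarrow> (r3(11 := Suc m)) q = r' q) \<and> M3 = M \<and>
          (r3(11 := Suc m)) 15 = of_bool (\<forall>j<Suc m. j \<in> S \<longleftrightarrow> j \<in> Cs ! k))"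
        by (rule runs_Assign)
          (use I m J S(2)[of m] e[of m] assms(2) in \<open>auto simp: less_Suc_eq\<close>)
    next
      fix r2 M2
      assume I: "(\<forall>q. q < 11 \<or> 11 < q \<and> q < 15 \<longrightarrow> r2 q = r' q) \<and> M2 = M \<and>
          r2 15 = of_bool (\<forall>j<n. j \<in> S \<longleftrightarrow> j \<in> Cs ! k)" and "r2 11 = n"
      then have "r2 15 = of_bool (S = Cs ! k)" using eq by simp
      then show "runs B (Seq (Assign 12 (Sub (Reg 12) (Reg 15))) (Assign 14 (Add (Reg 14) (Reg 2))))
          r2 M2 (\<lambda>r2 M2. r2 13 = k \<and> r2 9 = length Cs \<and> ?J (Suc k) (r2(13 := Suc k)) M2)"
        by (intro runs_intros) (use I J k assms(2,3) in \<open>auto simp: less_Suc_eq\<close>)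
    qed (use J assms in auto)
  next
    fix r' M' assume "?J (length Cs) r' M'"
    then show "(\<forall>q. q < 11 \<longrightarrow> r' q = r q) \<and> M' = M \<and> r' 12 = of_bool (P \<and> S \<notin> set Cs)"
      by (auto simp: in_set_conv_nth)
  qed (use assms in auto)
qed

section \<open>The family found so far and its size\<close>

definition candidates :: "nat \<Rightarrow> (nat \<Rightarrow> nat \<Rightarrow> bool) \<Rightarrow> nat set set" where
  "candidates n A = insert {} ((\<lambda>(a, b, c, d). common_nbrs n A a b c d) `
     ({..<n} \<times> {..<n} \<times> {..<n} \<times> {..<n}))"

lemma finite_candidates: "finite (candidates n A)"
  by (simp add: candidates_def)

lemma card_candidates: "card (candidates n A) \<le> 1 + n ^ 4"
proof -
  let ?T = "{..<n} \<times> {..<n} \<times> {..<n} \<times> {..<n}"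
  have "card (candidates n A) \<le> Suc (card ((\<lambda>(a, b, c, d). common_nbrs n A a b c d) ` ?T))"
    unfolding candidates_def by (simp add: card_insert_if)
  also have "\<dots> \<le> Suc (card ?T)" by (subst Suc_le_mono, rule card_image_le) simp
  also have "card ?T = n ^ 4" by (simp add: card_cartesian_product power4_eq_xxxx mult.assoc)
  finally show ?thesis by simp
qed

text \<open>The global invariant. The order of the rows is left open, so that it depends only on the
  set \<open>X\<close>; the cell at \<open>L + n\<close> stays reserved for the length
  header.\<close>

definition found :: "nat \<Rightarrow> (nat \<Rightarrow> nat \<Rightarrow> bool) \<Rightarrow> nat \<Rightarrow> nat set set \<Rightarrow>
    (nat \<Rightarrow> nat) \<Rightarrow> (nat \<Rightarrow> nat) \<Rightarrow> bool" where
  "found n A L X r M \<longleftrightarrow> r 0 = L \<and> r 1 = L + n \<and> r 2 = n \<and> stores_matrix n A L M \<and>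
     X \<subseteq> candidates n A \<and>
     (\<exists>Cs. distinct Cs \<and> set Cs = X \<and> stores_family n (L + n + 1) Cs M \<and>
        r 9 = length Cs \<and> r 8 = L + n + 1 + length Cs * n)"

text \<open>Distinctness turns the bound on the number of candidates into a bound on the number of
  rows, and thus on the iterations of every loop over the family.\<close>

lemma found_listE:
  assumes "found n A L X r M"
  obtains Cs where "distinct Cs" "set Cs = X" "stores_family n (L + n + 1) Cs M"
    "r 9 = length Cs" "r 8 = L + n + 1 + length Cs * n" "length Cs \<le> 1 + n ^ 4"
proof -
  obtain Cs where Cs: "distinct Cs" "set Cs = X" "stores_family n (L + n + 1) Cs M"
    "r 9 = length Cs" "r 8 = L + n + 1 + length Cs * n"
    using assms unfolding found_def by blast
  have "length Cs = card X" using Cs distinct_card by metis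
  also have "\<dots> \<le> card (candidates n A)"
    using assms finite_candidates unfolding found_def by (intro card_mono) auto
  finally show ?thesis using that[OF Cs] card_candidates[of n A] by simp
qed

lemma found_fun_upd:
  assumes "x \<in> {3..<8} \<or> 9 < x"
  shows "found n A L X (r(x := v)) M = found n A L X r M"
proof -
  have "x \<noteq> 0" "x \<noteq> 1" "x \<noteq> 2" "x \<noteq> 8" "x \<noteq> 9"
    using assms by auto
  then show ?thesis by (simp add: found_def)
qed

text \<open>The two conclusions serve the two outcomes of a visit: the new row is counted, or it is
  left as garbage behind the family.\<close>

lemma stores_family_append:
  assumes "stores_family n p Cs M" "\<And>x. x < p + length Cs * n \<Longrightarrow> M' x = M x"
    "\<And>j. j < n \<Longrightarrow> M' (p + length Cs * n + j) = of_bool (j \<in> S)"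
  shows "stores_family n p (Cs @ [S]) M'" "stores_family n p Cs M'"
proof -
  show *: "stores_family n p Cs M'"
    unfolding stores_family_def
  proof (intro allI impI)
    fix k j assume kj: "k < length Cs" "j < n"
    then have "M' (p + k * n + j) = M (p + k * n + j)"
      using assms(2)[of "p + k * n + j"] row_index_less[OF kj] by simp
    then show "M' (p + k * n + j) = of_bool (j \<in> Cs ! k)"
      using assms(1) kj by (simp add: stores_family_def)
  qed
  then show "stores_family n p (Cs @ [S]) M'"
    using assms(3) by (auto simp: stores_family_def nth_append less_Suc_eq)
qed

lemma runs_visit:
  assumes F: "found n A L X r M" and lt: "\<forall>q\<in>{3..6}. r q < n"
    and B: "n \<le> B" "1 + n ^ 4 \<le> B"
  shows "runs B visit r M (\<lambda>r' M'. found n A L (X \<union> spanned_set n A (r 3) (r 4) (r 5) (r 6)) r' M' \<and>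
      (\<forall>q\<le>6. r' q = r q))"
proof -
  let ?S = "common_nbrs n A (r 3) (r 4) (r 5) (r 6)"
  let ?P = "spanning n A (r 3) (r 4) (r 5) (r 6)"
  obtain Cs where F': "r 0 = L" "r 1 = L + n" "r 2 = n" "stores_matrix n A L M" "X \<subseteq> candidates n A"
    "distinct Cs" "set Cs = X" "stores_family n (L + n + 1) Cs M" "r 9 = length Cs"
    "r 8 = L + n + 1 + length Cs * n" "length Cs \<le> 1 + n ^ 4"
    using found_listE[OF F] F unfolding found_def by metis
  have lt': "r 3 < n" "r 4 < n" "r 5 < n" "r 6 < n" using lt by simp_all
  have Sc: "?S \<in> candidates n A" using lt' by (force simp: candidates_def)
  have sub: "C \<subseteq> {..<n}" if "C \<in> candidates n A" for C
    using that by (auto simp: candidates_def common_nbrs_def)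
  have len: "length Cs \<le> B" using F'(11) B(2) by simp
  show ?thesis unfolding visit_def
  proof (rule runs_Seq, rule runs_mono[OF runs_write_common_nbrs])
    fix r1 M1
    assume 1: "(\<forall>q. q \<noteq> 11 \<longrightarrow> r1 q = r q) \<and> (\<forall>x<r 8. M1 x = M x) \<and>
      (\<forall>j<n. M1 (r 8 + j) = of_bool (j \<in> ?S))"
    have mat: "stores_matrix n A L M1"
      using stores_matrix_cong[OF F'(4)] 1 F'(10) by simp
    have fam: "stores_family n (L + n + 1) Cs M1" "stores_family n (L + n + 1) (Cs @ [?S]) M1"
      using stores_family_append[OF F'(8), of M1 ?S] 1 F'(10) by (simp_all add: add.assoc)
    show "runs B (Seq test_spanning (Seq test_new (Cond (Reg 12)
        (Seq (Assign 8 (Add (Reg 8) (Reg 2))) (Assign 9 (Add (Reg 9) (Const 1)))) Skip))) r1 M1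
      (\<lambda>r' M'. found n A L (X \<union> spanned_set n A (r 3) (r 4) (r 5) (r 6)) r' M' \<and>
        (\<forall>q\<le>6. r' q = r q))"
    proof (rule runs_Seq, rule runs_mono[OF runs_test_spanning[OF mat]])
      fix r2 M2
      assume 2: "(\<forall>q. q \<noteq> 10 \<and> q \<noteq> 11 \<and> q \<noteq> 12 \<longrightarrow> r2 q = r1 q) \<and> M2 = M1 \<and>
        r2 12 = of_bool (spanning n A (r1 3) (r1 4) (r1 5) (r1 6))"
      have r2: "r2 q = r q" if "q < 10" for q using 1 2 that by simp
      show "runs B (Seq test_new (Cond (Reg 12)
          (Seq (Assign 8 (Add (Reg 8) (Reg 2))) (Assign 9 (Add (Reg 9) (Const 1)))) Skip)) r2 M2
        (\<lambda>r' M'. found n A L (X \<union> spanned_set n A (r 3) (r 4) (r 5) (r 6)) r' M' \<and>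
          (\<forall>q\<le>6. r' q = r q))"
      proof (rule runs_Seq, rule runs_mono[OF runs_test_new[where p = "L + n" and S = ?S and P = ?P
            and Cs = Cs and n = n]])
        fix r3 M3
        assume 3: "(\<forall>q. q < 11 \<longrightarrow> r3 q = r2 q) \<and> M3 = M2 \<and> r3 12 = of_bool (?P \<and> ?S \<notin> set Cs)"
        have r3: "r3 q = r q" if "q < 10" for q using 3 r2 that by simp
        have M3: "M3 = M1" using 2 3 by simp
        show "runs B (Cond (Reg 12)
            (Seq (Assign 8 (Add (Reg 8) (Reg 2))) (Assign 9 (Add (Reg 9) (Const 1)))) Skip) r3 M3
          (\<lambda>r' M'. found n A L (X \<union> spanned_set n A (r 3) (r 4) (r 5) (r 6)) r' M' \<and>
            (\<forall>q\<le>6. r' q = r q))"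
        proof (rule runs_Cond)
          assume "aval (Reg 12) (r3, M3) \<noteq> 0"
          then have P: ?P "?S \<notin> set Cs" using 3 by (auto split: if_splits)
          have "found n A L (insert ?S X) (r3(8 := r3 8 + n, 9 := Suc (r3 9))) M1"
            unfolding found_def using r3 mat fam(2) F' P(2) Sc
            by (auto intro!: exI[of _ "Cs @ [?S]"])
          moreover have "X \<union> spanned_set n A (r 3) (r 4) (r 5) (r 6) = insert ?S X"
            using P(1) by (simp add: spanned_set_def)
          ultimately show "runs B (Seq (Assign 8 (Add (Reg 8) (Reg 2))) (Assign 9 (Add (Reg 9) (Const 1))))
            r3 M3 (\<lambda>r' M'. found n A L (X \<union> spanned_set n A (r 3) (r 4) (r 5) (r 6)) r' M' \<and>
              (\<forall>q\<le>6. r' q = r q))"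
            by (intro runs_intros) (use M3 r3 F'(3) in simp)
        next
          assume "aval (Reg 12) (r3, M3) = 0"
          \<comment> \<open>Either the quadruple is not spanning and contributes nothing, or its set
            is already in \<open>X\<close>.\<close>
          then have "X \<union> spanned_set n A (r 3) (r 4) (r 5) (r 6) = X"
            using 3 F'(7) by (auto simp: spanned_set_def split: if_splits)
          moreover have "found n A L X r3 M1"
            unfolding found_def using r3 mat fam(1) F' by auto
          ultimately show "runs B Skip r3 M3
            (\<lambda>r' M'. found n A L (X \<union> spanned_set n A (r 3) (r 4) (r 5) (r 6)) r' M' \<and>
              (\<forall>q\<le>6. r' q = r q))"
            by (intro runs_Skip) (use M3 r3 in simp)
        qed
      qed (use F' r2 1 2 len B fam(1) sub Sc in auto)
    qed (use F' lt' 1 B in auto)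
  qed (use F' lt' B in auto)
qed

text \<open>One level of the nested loops over the registers 3 to 6. \<open>Y f\<close> is the family that the body
  contributes when the registers up to \<open>x\<close> agree with \<open>f\<close>.\<close>

lemma runs_For_found:
  assumes body: "\<And>X r M. found n A L X r M \<Longrightarrow> \<forall>q\<in>{3..x}. r q < n \<Longrightarrow>
      runs B c r M (\<lambda>r' M'. found n A L (X \<union> Y r) r' M' \<and> (\<forall>q\<le>x. r' q = r q))"
    and Y: "\<And>f g. (\<And>q. q \<le> x \<Longrightarrow> f q = g q) \<Longrightarrow> Y f = Y g"
    and x: "x \<in> {3..6}" and "n \<le> B"
    and F: "found n A L X r M" and lt: "\<forall>q\<in>{3..<x}. r q < n"
  shows "runs B (For x 2 c) r M (\<lambda>r' M'. found n A L (X \<union> (\<Union>v<n. Y (r(x := v)))) r' M' \<and>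
      (\<forall>q<x. r' q = r q))"
proof (rule runs_For[where N = n and I = "\<lambda>k r' M'.
    found n A L (X \<union> (\<Union>v<k. Y (r(x := v)))) r' M' \<and> (\<forall>q<x. r' q = r q)"])
  fix k r' M'
  assume I: "found n A L (X \<union> (\<Union>v<k. Y (r(x := v)))) r' M' \<and> (\<forall>q<x. r' q = r q)"
    and k: "r' x = k" "r' 2 = n" "k < n"
  have lt': "\<forall>q\<in>{3..x}. r' q < n"
    using I k lt by (auto simp: le_less)
  \<comment> \<open>\<open>Y\<close> looks only at registers up to \<open>x\<close>; those below
    \<open>x\<close> are unchanged and \<open>x\<close> itself holds \<open>k\<close>.\<close>
  have "Y r' = Y (r(x := k))" by (rule Y) (use I k in auto)
  then have "X \<union> (\<Union>v<k. Y (r(x := v))) \<union> Y r' = X \<union> (\<Union>v<Suc k. Y (r(x := v)))"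
    by (auto simp: lessThan_Suc)
  then show "runs B c r' M' (\<lambda>r2 M2. r2 x = k \<and> r2 2 = n \<and>
      found n A L (X \<union> (\<Union>v<Suc k. Y (r(x := v)))) (r2(x := Suc k)) M2 \<and>
      (\<forall>q<x. (r2(x := Suc k)) q = r q))"
    using I k x by (intro runs_mono[OF body[OF _ lt']]) (auto simp: found_fun_upd)
qed (use F x \<open>n \<le> B\<close> in \<open>auto simp: found_fun_upd, auto simp: found_def\<close>)

text \<open>The loops are treated from the inside out: the union contributed by one level is the
  \<open>Y\<close> of the level around it.\<close>

lemma runs_visit_all:
  assumes F: "found n A L X r M" and B: "n \<le> B" "1 + n ^ 4 \<le> B"
  shows "runs B (For 3 2 (For 4 2 (For 5 2 (For 6 2 visit)))) r M (\<lambda>r' M'.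
     found n A L (X \<union> (\<Union>a<n. \<Union>b<n. \<Union>c<n. \<Union>d<n. spanned_set n A a b c d)) r' M')"
proof -
  have s6: "runs B (For 6 2 visit) r M (\<lambda>r' M'.
      found n A L (X \<union> (\<Union>d<n. spanned_set n A (r 3) (r 4) (r 5) d)) r' M' \<and> (\<forall>q\<le>5. r' q = r q))"
    if "found n A L X r M" "\<forall>q\<in>{3..5}. r q < n" for X r M
  proof (rule runs_mono[OF runs_For_found[where x = 6 and X = X and r = r and M = M and n = n and A = A
        and L = L and Y = "\<lambda>f. spanned_set n A (f 3) (f 4) (f 5) (f 6)"]])
    fix X r M assume "found n A L X r M" "\<forall>q\<in>{3..6}. r q < n"
    then show "runs B visit r M (\<lambda>r' M'.
        found n A L (X \<union> spanned_set n A (r 3) (r 4) (r 5) (r 6)) r' M' \<and> (\<forall>q\<le>6. r' q = r q))"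
      by (rule runs_visit[OF _ _ B])
  qed (use that B in auto)
  have s5: "runs B (For 5 2 (For 6 2 visit)) r M (\<lambda>r' M'.
      found n A L (X \<union> (\<Union>c<n. \<Union>d<n. spanned_set n A (r 3) (r 4) c d)) r' M' \<and> (\<forall>q\<le>4. r' q = r q))"
    if "found n A L X r M" "\<forall>q\<in>{3..4}. r q < n" for X r M
  proof (rule runs_mono[OF runs_For_found[where x = 5 and X = X and r = r and M = M and n = n and A = A
        and L = L and Y = "\<lambda>f. \<Union>d<n. spanned_set n A (f 3) (f 4) (f 5) d"]])
    fix X r M assume "found n A L X r M" "\<forall>q\<in>{3..5}. r q < n"
    then show "runs B (For 6 2 visit) r M (\<lambda>r' M'.
        found n A L (X \<union> (\<Union>d<n. spanned_set n A (r 3) (r 4) (r 5) d)) r' M' \<and> (\<forall>q\<le>5. r' q = r q))"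
      by (rule s6)
  qed (use that B in auto)
  have three: "q = 3" if "3 \<le> q" "q < 4" for q :: nat using that by simp
  have s4: "runs B (For 4 2 (For 5 2 (For 6 2 visit))) r M (\<lambda>r' M'.
      found n A L (X \<union> (\<Union>b<n. \<Union>c<n. \<Union>d<n. spanned_set n A (r 3) b c d)) r' M' \<and> (\<forall>q\<le>3. r' q = r q))"
    if "found n A L X r M" "\<forall>q\<in>{3..3}. r q < n" for X r M
  proof (rule runs_mono[OF runs_For_found[where x = 4 and X = X and r = r and M = M and n = n and A = A
        and L = L and Y = "\<lambda>f. \<Union>c<n. \<Union>d<n. spanned_set n A (f 3) (f 4) c d"]])
    fix X r M assume "found n A L X r M" "\<forall>q\<in>{3..4}. r q < n"
    then show "runs B (For 5 2 (For 6 2 visit)) r M (\<lambda>r' M'.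
        found n A L (X \<union> (\<Union>c<n. \<Union>d<n. spanned_set n A (r 3) (r 4) c d)) r' M' \<and> (\<forall>q\<le>4. r' q = r q))"
      by (rule s5)
  qed (use that B in \<open>auto dest!: three\<close>)
  show ?thesis
  proof (rule runs_mono[OF runs_For_found[where x = 3 and X = X and r = r and M = M and n = n and A = A
        and L = L and Y = "\<lambda>f. \<Union>b<n. \<Union>c<n. \<Union>d<n. spanned_set n A (f 3) b c d"]])
    fix X r M assume "found n A L X r M" "\<forall>q\<in>{3..3}. r q < n"
    then show "runs B (For 4 2 (For 5 2 (For 6 2 visit))) r M (\<lambda>r' M'.
        found n A L (X \<union> (\<Union>b<n. \<Union>c<n. \<Union>d<n. spanned_set n A (r 3) b c d)) r' M' \<and> (\<forall>q\<le>3. r' q = r q))"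
      by (rule s4)
  qed (use F B in auto)
qed

section \<open>Preparation and the full enumeration\<close>

lemma runs_prepare:
  assumes "r 0 = L" "L = 1 + n * n" "M 0 = n" "n \<le> B"
    and M: "\<forall>i<n. \<forall>j<n. M (1 + i * n + j) = of_bool (E i j)"
  shows "runs B prepare r M (found n (\<lambda>i j. i = j \<or> E i j) L (if n = 0 then {{}} else {}))"
proof -
  \<comment> \<open>Row \<open>i\<close> starts at \<open>1 + i * n\<close>, the 1 skipping the cell
    that holds \<open>n\<close>. After \<open>k\<close> rounds the diagonal is set in the first
    \<open>k\<close> rows only.\<close>
  let ?J = "\<lambda>k (r' :: nat \<Rightarrow> nat) M'. r' 0 = L \<and> r' 2 = n \<and> r' 8 = 1 + k * n \<and> (\<forall>i<k. M' (L + i) = 1 + i * n) \<and>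
     (\<forall>i<n. \<forall>j<n. M' (1 + i * n + j) = of_bool (i = j \<and> i < k \<or> E i j))"
  have in_matrix: "1 + i * n + j < L" if "i < n" "j < n" for i j
    using row_index_less[OF that] assms(2) by simp
  show ?thesis unfolding prepare_def
  proof (rule runs_Seq, rule runs_Assign, rule runs_Seq, rule runs_Assign, rule runs_Seq,
      rule runs_For[where N = n and I = ?J])
    fix k and r' M' :: "nat \<Rightarrow> nat"
    assume J: "?J k r' M'" and k: "r' 10 = k" "k < n"
    let ?M = "M'(L + k := 1 + k * n, 1 + k * n + k := 1)"
    have ptr: "?M (L + i) = 1 + i * n" if "i < Suc k" for i
    proof -
      \<comment> \<open>The two stores of a round do not interfere: diagonal entries lie below
        \<open>L\<close>, row pointers from \<open>L\<close> on.\<close>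
      have "L + i \<noteq> 1 + k * n + k" using in_matrix[of k k] k(2) by simp
      then show ?thesis using J that by (auto simp: less_Suc_eq)
    qed
    have mat: "?M (1 + i * n + j) = of_bool (i = j \<and> i < Suc k \<or> E i j)" if "i < n" "j < n" for i j
    proof -
      have "1 + i * n + j \<noteq> L + k" using in_matrix[OF that] by simp
      moreover have "1 + i * n + j = 1 + k * n + k \<longleftrightarrow> i = k \<and> j = k"
        using row_index_inject[OF \<open>j < n\<close> k(2), of i k] by simp
      moreover have "M' (1 + i * n + j) = of_bool (i = j \<and> i < k \<or> E i j)" using J that by blast
      ultimately show ?thesis by (auto simp del: One_nat_def simp: less_Suc_eq)
    qed
    show "runs B (Seq (Store (Add (Reg 0) (Reg 10)) (Reg 8))
        (Seq (Store (Add (Reg 8) (Reg 10)) (Const 1)) (Assign 8 (Add (Reg 8) (Reg 2))))) r' M'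
      (\<lambda>r2 M2. r2 10 = k \<and> r2 2 = n \<and> ?J (Suc k) (r2(10 := Suc k)) M2)"
      by (intro runs_intros) (use J k ptr mat in simp)
  next
    fix r' M' assume J: "?J n r' M'"
    then have "stores_matrix n (\<lambda>i j. i = j \<or> E i j) L M'"
      unfolding stores_matrix_def
    proof (intro allI impI conjI)
      fix i assume i: "i < n"
      then have p: "M' (L + i) = 1 + i * n" using J by blast
      have "Suc i * n \<le> n * n" using i by (intro mult_right_mono) auto
      then show "M' (L + i) + n \<le> L" using p assms(2) by simp
      fix j assume "j < n"
      then show "M' (M' (L + i) + j) = of_bool (i = j \<or> E i j)"
        using conjunct2[OF conjunct2[OF conjunct2[OF conjunct2[OF J]]]] i unfolding p by simp
    qed
    \<comment> \<open>The count \<open>1 - n\<close> is 1 exactly for \<open>n = 0\<close>; the row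
      of the empty set then has width 0, so the end pointer is the same in both cases.\<close>
    then have "found n (\<lambda>i j. i = j \<or> E i j) L (if n = 0 then {{}} else {})
        (r'(1 := L + n, 8 := L + n + 1, 9 := 1 - n)) M'"
      using J unfolding found_def
      by (auto simp: candidates_def stores_family_def intro!: exI[of _ "if n = 0 then [{}] else []"])
    then show "runs B (Seq (Assign 1 (Add (Reg 0) (Reg 2))) (Seq (Assign 8 (Add (Reg 1) (Const 1)))
        (Assign 9 (Sub (Const 1) (Reg 2))))) r' M'
      (found n (\<lambda>i j. i = j \<or> E i j) L (if n = 0 then {{}} else {}))"
      by (intro runs_intros) (use J in simp)
  qed (use assms in auto)
qed

lemma runs_enumerate_all:
  assumes "r 0 = L" "L = 1 + n * n" "M 0 = n" "n \<le> B" "1 + n ^ 4 \<le> B"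
    and "\<forall>i<n. \<forall>j<n. M (1 + i * n + j) = of_bool (E i j)"
  shows "runs B enumerate_all r M (found n (\<lambda>i j. i = j \<or> E i j) L
    (spanned_sets n (\<lambda>i j. i = j \<or> E i j)))"
  unfolding enumerate_all_def
proof (rule runs_Seq, rule runs_mono[OF runs_prepare[where r = r and M = M and E = E,
      OF assms(1-4,6)]])
  fix r' M'
  assume "found n (\<lambda>i j. i = j \<or> E i j) L (if n = 0 then {{}} else {}) r' M'"
  from runs_visit_all[OF this assms(4,5)]
  show "runs B (For 3 2 (For 4 2 (For 5 2 (For 6 2 visit)))) r' M'
      (found n (\<lambda>i j. i = j \<or> E i j) L (spanned_sets n (\<lambda>i j. i = j \<or> E i j)))"
    unfolding spanned_sets_def .
qed

section \<open>The two output phases\<close>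

lemma runs_output_family:
  assumes F: "found n A L X r M"
  shows "runs B (Seq (Store (Reg 1) (Reg 9)) (Assign 0 (Sub (Reg 8) (Reg 1)))) r M (\<lambda>r' M'.
    (\<exists>Cs. distinct Cs \<and> set Cs = X \<and> ram_output (r', M') = family_code n Cs) \<and>
    r' 0 \<le> 1 + (1 + n ^ 4) * n)"
proof -
  obtain Cs where Cs: "distinct Cs" "set Cs = X" "stores_family n (L + n + 1) Cs M"
    "r 9 = length Cs" "r 8 = L + n + 1 + length Cs * n" "length Cs \<le> 1 + n ^ 4"
    using F by (rule found_listE)
  have r1: "r 1 = L + n" using F by (simp add: found_def)
  let ?M = "M(L + n := length Cs)"
  have "stores_family n (L + n + 1) Cs ?M"
    using Cs(3) by (simp add: stores_family_def)
  then have "map ?M [L + n..<L + n + (1 + length Cs * n)] = family_code n Cs"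
    by (intro family_code_eq) simp_all
  \<comment> \<open>The output length counts towards the running time and so needs a bound
    too.\<close>
  moreover have "length Cs * n \<le> (1 + n ^ 4) * n" using Cs(6) by (rule mult_right_mono) simp
  ultimately show ?thesis
    by (intro runs_intros) (use Cs r1 in \<open>auto simp: ram_output_def simp del: upt_Suc\<close>)
qed

lemma card_Int_lessThan_Suc: "card (C \<inter> {..<Suc m}) = card (C \<inter> {..<m}) + of_bool (m \<in> C)"
proof -
  have "C \<inter> {..<Suc m} = (if m \<in> C then insert m (C \<inter> {..<m}) else C \<inter> {..<m})"
    by (auto simp: less_Suc_eq)
  then show ?thesis by simp
qed

lemma runs_output_max_card:
  assumes F: "found n A L X r M" and B: "n \<le> B" "1 + n ^ 4 \<le> B"
    and X: "\<And>C. C \<in> X \<Longrightarrow> C \<subseteq> {..<n}"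
  shows "runs B (Seq (Assign 16 (Const 0)) (Seq (Assign 14 (Add (Reg 1) (Const 1)))
     (Seq (For 13 9 (Seq (Assign 15 (Const 0))
        (Seq (For 11 2 (Assign 15 (Add (Reg 15) (cell 14 11))))
        (Seq (Assign 16 (Add (Reg 16) (Sub (Reg 15) (Reg 16)))) (Assign 14 (Add (Reg 14) (Reg 2)))))))
     (Seq (Store (Const 0) (Reg 16)) (Seq (Assign 0 (Const 1)) (Assign 1 (Const 0))))))) r M
     (\<lambda>r' M'. r' 0 = 1 \<and> (\<exists>m. ram_output (r', M') = [m] \<and> (\<forall>C\<in>X. card C \<le> m) \<and>
        (m = 0 \<or> (\<exists>C\<in>X. card C = m))))"
proof -
  obtain Cs where Cs: "distinct Cs" "set Cs = X" "stores_family n (L + n + 1) Cs M"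
    "r 9 = length Cs" "r 8 = L + n + 1 + length Cs * n" "length Cs \<le> 1 + n ^ 4"
    using F by (rule found_listE)
  have r: "r 1 = L + n" "r 2 = n" using F by (simp_all add: found_def)
  let ?J = "\<lambda>k r' M'. (\<forall>q<11. r' q = r q) \<and> M' = M \<and> r' 14 = L + n + 1 + k * n \<and>
      (\<forall>i<k. card (Cs ! i) \<le> r' 16) \<and> (r' 16 = 0 \<or> (\<exists>i<k. card (Cs ! i) = r' 16))"
  show ?thesis
  proof (rule runs_Seq, rule runs_Assign, rule runs_Seq, rule runs_Assign, rule runs_Seq,
      rule runs_For[where N = "length Cs" and I = ?J])
    fix k r' M'
    assume J: "?J k r' M'" and k: "r' 13 = k" "k < length Cs"
    have e: "M (L + n + 1 + k * n + j) = of_bool (j \<in> Cs ! k)" if "j < n" for j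
      using Cs(3) k that by (simp add: stores_family_def)
    show "runs B (Seq (Assign 15 (Const 0))
        (Seq (For 11 2 (Assign 15 (Add (Reg 15) (cell 14 11))))
        (Seq (Assign 16 (Add (Reg 16) (Sub (Reg 15) (Reg 16)))) (Assign 14 (Add (Reg 14) (Reg 2)))))) r' M'
       (\<lambda>r2 M2. r2 13 = k \<and> r2 9 = length Cs \<and> ?J (Suc k) (r2(13 := Suc k)) M2)"
    proof (rule runs_Seq, rule runs_Assign, rule runs_Seq, rule runs_For[where N = n and
        I = "\<lambda>m r2 M2. (\<forall>q. q \<noteq> 11 \<and> q \<noteq> 15 \<longrightarrow> r2 q = r' q) \<and> M2 = M \<and>
          r2 15 = card (Cs ! k \<inter> {..<m})"])
      fix m r2 M2
      assume I: "(\<forall>q. q \<noteq> 11 \<and> q \<noteq> 15 \<longrightarrow> r2 q = r' q) \<and> M2 = M \<and>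
          r2 15 = card (Cs ! k \<inter> {..<m})" and m: "r2 11 = m" "m < n"
      show "runs B (Assign 15 (Add (Reg 15) (cell 14 11))) r2 M2 (\<lambda>r3 M3. r3 11 = m \<and> r3 2 = n \<and>
          (\<forall>q. q \<noteq> 11 \<and> q \<noteq> 15 \<longrightarrow> (r3(11 := Suc m)) q = r' q) \<and> M3 = M \<and>
          (r3(11 := Suc m)) 15 = card (Cs ! k \<inter> {..<Suc m}))"
        by (rule runs_Assign) (use I m J e[of m] r in \<open>simp add: card_Int_lessThan_Suc\<close>)
    next
      fix r2 M2
      assume I: "(\<forall>q. q \<noteq> 11 \<and> q \<noteq> 15 \<longrightarrow> r2 q = r' q) \<and> M2 = M \<and>
          r2 15 = card (Cs ! k \<inter> {..<n})"
      moreover have "Cs ! k \<inter> {..<n} = Cs ! k" using X Cs(2) k(2) nth_mem by blast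
      ultimately have 15: "r2 15 = card (Cs ! k)" by simp
      \<comment> \<open>\<open>le\<close> and \<open>at\<close> say that the updated register 16 is
        still an upper bound and still attained, or 0.\<close>
      have le: "card (Cs ! i) \<le> r' 16 + (card (Cs ! k) - r' 16)" if "i < Suc k" for i
        using J that by (cases "i = k") (auto simp: less_Suc_eq trans_le_add1)
      have at: "r' 16 + (card (Cs ! k) - r' 16) = 0 \<or>
          (\<exists>i<Suc k. card (Cs ! i) = r' 16 + (card (Cs ! k) - r' 16))"
      proof (cases "card (Cs ! k) \<le> r' 16")
        case True
        then show ?thesis using J less_SucI by auto
      qed auto
      show "runs B (Seq (Assign 16 (Add (Reg 16) (Sub (Reg 15) (Reg 16))))
          (Assign 14 (Add (Reg 14) (Reg 2)))) r2 M2
        (\<lambda>r2 M2. r2 13 = k \<and> r2 9 = length Cs \<and> ?J (Suc k) (r2(13 := Suc k)) M2)"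
        by (intro runs_intros) (use I J k r Cs(4) le at in \<open>simp add: 15\<close>)
    qed (use J r B in auto)
  next
    fix r' M' assume J: "?J (length Cs) r' M'"
    have "\<forall>C\<in>X. card C \<le> r' 16"
      using J unfolding Cs(2)[symmetric] by (auto simp: in_set_conv_nth)
    moreover have "r' 16 = 0 \<or> (\<exists>C\<in>X. card C = r' 16)"
      using J unfolding Cs(2)[symmetric] by (metis nth_mem)
    ultimately show "runs B (Seq (Store (Const 0) (Reg 16)) (Seq (Assign 0 (Const 1)) (Assign 1 (Const 0)))) r' M'
      (\<lambda>r' M'. r' 0 = 1 \<and> (\<exists>m. ram_output (r', M') = [m] \<and> (\<forall>C\<in>X. card C \<le> m) \<and>
        (m = 0 \<or> (\<exists>C\<in>X. card C = m))))"
      by (intro runs_intros) (simp add: ram_output_def)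
  qed (use r Cs B in auto)
qed

section \<open>From bounded runs to polynomial time\<close>

lemma poly_time_solvable_graphI:
  assumes "\<And>n E L r M. (n, E) \<in> D \<Longrightarrow> L = 1 + n * n \<Longrightarrow> r 0 = L \<Longrightarrow> M 0 = n \<Longrightarrow>
      \<forall>i<n. \<forall>j<n. M (1 + i * n + j) = of_bool ({i, j} \<in> E) \<Longrightarrow>
      runs (L ^ 2) c r M (\<lambda>r' M'. correct (n, E) (ram_output (r', M')) \<and> r' 0 \<le> 1 + L ^ 3)"
  shows "poly_time_solvable D graph_code correct"
  unfolding poly_time_solvable_def
\<comment> \<open>Iterations are bounded by the square of the input length, hence the composition
  with \<open>monom 1 2\<close>; the other summands pay for the output length.\<close>
proof (rule exI[of _ c], rule exI[of _ "pcompose (time_poly c) (monom 1 2) + 1 + monom 1 3"],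
    rule ballI)
  fix x assume "x \<in> D"
  then obtain n E where x: "x = (n, E)" "(n, E) \<in> D" by (cases x) auto
  let ?L = "1 + n * n"
  obtain r M where rM: "ram_input (graph_code x) = (r, M)" by fastforce
  have r: "r = (\<lambda>_. 0)(0 := ?L)" and M: "\<And>a. a < ?L \<Longrightarrow> M a = graph_code x ! a"
    using rM length_graph_code[of n E] by (auto simp: ram_input_def x(1))
  have "runs (?L ^ 2) c r M (\<lambda>r' M'. correct (n, E) (ram_output (r', M')) \<and> r' 0 \<le> 1 + ?L ^ 3)"
  proof (rule assms[OF x(2)])
    show "M 0 = n" using M[of 0] by (simp add: x(1) graph_code_def)
    show "\<forall>i<n. \<forall>j<n. M (1 + i * n + j) = of_bool ({i, j} \<in> E)"
    proof (intro allI impI)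
      fix i j assume ij: "i < n" "j < n"
      then show "M (1 + i * n + j) = of_bool ({i, j} \<in> E)"
        using M[of "1 + i * n + j"] row_index_less[OF ij] nth_graph_code[OF ij] by (simp add: x(1))
    qed
  qed (simp_all add: r)
  then obtain t r' M' where t: "exec c (r, M) t (r', M')" "t \<le> poly (time_poly c) (?L ^ 2)"
    "correct (n, E) (ram_output (r', M'))" "r' 0 \<le> 1 + ?L ^ 3"
    unfolding runs_def by blast
  have "t + length (ram_output (r', M')) \<le>
      poly (pcompose (time_poly c) (monom 1 2) + 1 + monom 1 3) (length (graph_code x))"
    using t(2,4) length_graph_code[of n E]
    by (simp add: x(1) poly_pcompose poly_monom ram_output_def)
  then show "\<exists>t s. exec c (ram_input (graph_code x)) t s \<and>
      t + length (ram_output s) \<le>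
        poly (pcompose (time_poly c) (monom 1 2) + 1 + monom 1 3) (length (graph_code x)) \<and>
      correct x (ram_output s)"
    using t(1,3) rM x(1) by metis
qed

text \<open>Expanding the square gives \<open>L ^ 2 = 1 + 2 * (n * n) + n ^ 4\<close>; the cubic
  bound on the output length follows with \<open>n \<le> L\<close>.\<close>

lemma loop_bounds:
  fixes n :: nat
  assumes "L = 1 + n * n"
  shows "n \<le> L ^ 2" "1 + n ^ 4 \<le> L ^ 2" "1 + (1 + n ^ 4) * n \<le> 1 + L ^ 3"
proof -
  have sq: "L ^ 2 = 1 + 2 * (n * n) + n ^ 4"
    by (simp add: assms power2_eq_square power4_eq_xxxx algebra_simps)
  have "n \<le> n * n" by (cases n) auto
  then have "n \<le> L" unfolding assms by (rule trans_le_add2)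
  also have "L * 1 \<le> L * L" by (rule mult_le_mono) (simp_all add: assms)
  finally show "n \<le> L ^ 2" by (simp add: power2_eq_square)
  show 1: "1 + n ^ 4 \<le> L ^ 2" using sq by simp
  have "(1 + n ^ 4) * n \<le> L ^ 2 * L" using 1 \<open>n \<le> L\<close> by (rule mult_mono) auto
  also have "\<dots> = L ^ 3" by (simp add: power2_eq_square power3_eq_cube)
  finally show "1 + (1 + n ^ 4) * n \<le> 1 + L ^ 3" by simp
qed

theorem theorem1:
  fixes \<epsilon> :: real
  assumes "0 < \<epsilon>" and "\<epsilon> < 1"
  shows "poly_time_solvable {(n, E). is_2SUIG \<epsilon> {..<n} E} graph_code enumerates_maximal_cliques \<and>
         poly_time_solvable {(n, E). is_2SUIG \<epsilon> {..<n} E} graph_code computes_clique_number"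
proof (intro conjI; rule poly_time_solvable_graphI)
  \<comment> \<open>The commands are still schematic in both goals and are instantiated by the two
    \<open>show\<close> statements, so one context serves both programs.\<close>
  fix n E L and r M :: "nat \<Rightarrow> nat"
  assume "(n, E) \<in> {(n, E). is_2SUIG \<epsilon> {..<n} E}" and L: "L = 1 + n * n" and r: "r 0 = L"
    and M: "M 0 = n" "\<forall>i<n. \<forall>j<n. M (1 + i * n + j) = of_bool ({i, j} \<in> E)"
  then have cliques: "{C. maximal_clique {..<n} E C} = spanned_sets n (\<lambda>i j. i = j \<or> {i, j} \<in> E)"
    (is "_ = ?X")
    by (intro maximal_cliques_eq_spanned_sets[of _ E \<epsilon>]) auto
  note B = loop_bounds[OF L]
  note run = runs_enumerate_all[where r = r and M = M and E = "\<lambda>i j. {i, j} \<in> E", OF r L M(1) B(1,2) M(2)]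
  show "runs (L ^ 2) output_cliques r M (\<lambda>r' M'.
      enumerates_maximal_cliques (n, E) (ram_output (r', M')) \<and> r' 0 \<le> 1 + L ^ 3)"
    unfolding output_cliques_def
  proof (rule runs_Seq, rule runs_mono[OF run])
    fix r M assume "found n (\<lambda>i j. i = j \<or> {i, j} \<in> E) L ?X r M"
    from runs_output_family[OF this]
    show "runs (L ^ 2) (Seq (Store (Reg 1) (Reg 9)) (Assign 0 (Sub (Reg 8) (Reg 1)))) r M (\<lambda>r' M'.
        enumerates_maximal_cliques (n, E) (ram_output (r', M')) \<and> r' 0 \<le> 1 + L ^ 3)"
      by (rule runs_mono) (use B(3) cliques in \<open>auto simp: enumerates_maximal_cliques_def\<close>)
  qed
  show "runs (L ^ 2) output_clique_number r M (\<lambda>r' M'.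
      computes_clique_number (n, E) (ram_output (r', M')) \<and> r' 0 \<le> 1 + L ^ 3)"
    unfolding output_clique_number_def
  proof (rule runs_Seq, rule runs_mono[OF run], rule runs_mono[OF runs_output_max_card[OF _ B(1,2)]])
    show "C \<subseteq> {..<n}" if "C \<in> ?X" for C
      using that unfolding cliques[symmetric] by (simp add: maximal_clique_def clique_def)
    fix r' M'
    assume "r' 0 = 1 \<and> (\<exists>m. ram_output (r', M') = [m] \<and> (\<forall>C\<in>?X. card C \<le> m) \<and>
        (m = 0 \<or> (\<exists>C\<in>?X. card C = m)))"
    then obtain m where m: "r' 0 = 1" "ram_output (r', M') = [m]" "\<forall>C\<in>?X. card C \<le> m"
      "m = 0 \<or> (\<exists>C\<in>?X. card C = m)" by blast
    have "clique_number {..<n} E = m"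
      by (rule clique_number_eqI) (use m(3,4) in \<open>auto simp flip: cliques\<close>)
    then show "computes_clique_number (n, E) (ram_output (r', M')) \<and> r' 0 \<le> 1 + L ^ 3"
      using m by (simp add: computes_clique_number_def)
  qed
qed

end
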